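(* Let $\alpha,\beta,\gamma$ be compositions with $|\alpha|=|\beta|$, and let $S$ and $T$ be proper caterpillars such that $\Phi(S)=\{\alpha\circ\gamma,\ \text{reverse of }\alpha\circ\gamma\}$ and $\Phi(T)=\{\beta\circ\gamma,\ \text{reverse of }\beta\circ\gamma\}$. If $\gamma$ is not a palindrome and $\alpha\neq\beta$, then the $U$-polynomials of $S$ and $T$ are distinct.
   Context: A composition is a finite nonempty sequence $\alpha=\alpha_1\cdots\alpha_k$ of positive integers, with size $|\alpha|=\sum_i\alpha_i$ and length $\ell(\alpha)=k$; it is a palindrome if it equals its reverse $\alpha_k\cdots\alpha_1$. Concatenation: $\alpha\cdot\beta=\alpha_1\cdots\alpha_k\beta_1\cdots\beta_l$. Near-concatenation: $\alpha\odot\beta=\alpha_1\cdots\alpha_{k-1}(\alpha_k+\beta_1)\beta_2\cdots\beta_l$. Write $\gamma^{\odot i}=\gamma\odot\cdots\odot\gamma$ ($i$ copies), and for $\beta=\beta_1\cdots\beta_k$ define $\beta\circ\gamma=\gamma^{\odot\beta_1}\cdot\gamma^{\odot\beta_2}\cdots\gamma^{\odot\beta_k}$. For a tree $T=(V,E)$, $U_T(\mathbf{x})=\sum_{A\subseteq E}\mathbf{x}_{\lambda(A)}$, where $\lambda(A)$ is the partition of $|V|$ formed by the component sizes of $(V,A)$ and $\mathbf{x}_\lambda=x_{\lambda_1}\cdots x_{\lambda_l}$. A caterpillar is a tree whose internal (non-leaf) vertices induce a non-trivial path (the spine); it is proper if every internal vertex is adjacent to a leaf. For a proper caterpillar with spine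 $v_1\cdots v_k$, $\beta_i$ is $1$ plus the number of leaves adjacent to $v_i$, and $\Phi(T)=\{\beta_1\cdots\beta_k,\ \beta_k\cdots\beta_1\}$. *)

theory Defs
  imports Main "HOL-Library.Multiset"
begin

definition is_composition :: "nat list \<Rightarrow> bool" where
  "is_composition xs \<longleftrightarrow> xs \<noteq> [] \<and> (\<forall>x\<in>set xs. 0 < x)"

definition comp_size :: "nat list \<Rightarrow> nat" where
  "comp_size xs = sum_list xs"

definition is_palindrome :: "nat list \<Rightarrow> bool" where
  "is_palindrome xs \<longleftrightarrow> rev xs = xs"

text \<open>Near-concatenation (for nonempty arguments).\<close>
definition near_concat :: "nat list \<Rightarrow> nat list \<Rightarrow> nat list" where
  "near_concat xs ys = butlast xs @ [last xs + hd ys] @ tl ys"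

fun near_pow :: "nat list \<Rightarrow> nat \<Rightarrow> nat list" where
  "near_pow g 0 = []"
| "near_pow g (Suc 0) = g"
| "near_pow g (Suc (Suc n)) = near_concat g (near_pow g (Suc n))"

definition comp_circ :: "nat list \<Rightarrow> nat list \<Rightarrow> nat list" where
  "comp_circ b g = concat (map (near_pow g) b)"

definition edges_ok :: "'a set \<Rightarrow> 'a set set \<Rightarrow> bool" where
  "edges_ok V E \<longleftrightarrow> (\<forall>e\<in>E. \<exists>u v. e = {u, v} \<and> u \<noteq> v \<and> u \<in> V \<and> v \<in> V)"

definition adj :: "'a set set \<Rightarrow> 'a \<Rightarrow> 'a \<Rightarrow> bool" where
  "adj E u v \<longleftrightarrow> u \<noteq> v \<and> {u, v} \<in> E"

definition reach :: "'a set set \<Rightarrow> 'a \<Rightarrow> 'a \<Rightarrow> bool" where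
  "reach E = (adj E)\<^sup>*\<^sup>*"

definition connected_graph :: "'a set \<Rightarrow> 'a set set \<Rightarrow> bool" where
  "connected_graph V E \<longleftrightarrow> (\<forall>u\<in>V. \<forall>v\<in>V. reach E u v)"

definition is_tree :: "'a set \<Rightarrow> 'a set set \<Rightarrow> bool" where
  "is_tree V E \<longleftrightarrow> finite V \<and> V \<noteq> {} \<and> edges_ok V E \<and> connected_graph V E
     \<and> card E + 1 = card V"

definition degree :: "'a set set \<Rightarrow> 'a \<Rightarrow> nat" where
  "degree E v = card {e\<in>E. v \<in> e}"

definition leaves :: "'a set \<Rightarrow> 'a set set \<Rightarrow> 'a set" where
  "leaves V E = {v\<in>V. degree E v = 1}"

definition internal :: "'a set \<Rightarrow> 'a set set \<Rightarrow> 'a set" where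
  "internal V E = V - leaves V E"

definition component :: "'a set \<Rightarrow> 'a set set \<Rightarrow> 'a \<Rightarrow> 'a set" where
  "component V A v = {w\<in>V. reach A v w}"

definition comp_partition :: "'a set \<Rightarrow> 'a set set \<Rightarrow> nat multiset" where
  "comp_partition V A = image_mset card (mset_set (component V A ` V))"

text \<open>U_T = sum over A of x_lambda(A). Since the monomials x_lambda for distinct
  partitions lambda are distinct, U_T is represented faithfully by its coefficient
  data: the multiset of partitions lambda(A), A ranging over subsets of E.\<close>
definition U_poly :: "'a set \<Rightarrow> 'a set set \<Rightarrow> nat multiset multiset" where
  "U_poly V E = image_mset (comp_partition V) (mset_set (Pow E))"

definition is_spine :: "'a set \<Rightarrow> 'a set set \<Rightarrow> 'a list \<Rightarrow> bool" where
  "is_spine V E vs \<longleftrightarrow> distinct vs \<and> set vs = internal V E \<and> 2 \<le> length vs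
     \<and> (\<forall>i j. i < length vs \<longrightarrow> j < length vs \<longrightarrow>
            (adj E (vs ! i) (vs ! j) \<longleftrightarrow> (i = j + 1 \<or> j = i + 1)))"

definition is_caterpillar :: "'a set \<Rightarrow> 'a set set \<Rightarrow> bool" where
  "is_caterpillar V E \<longleftrightarrow> is_tree V E \<and> (\<exists>vs. is_spine V E vs)"

definition is_proper_caterpillar :: "'a set \<Rightarrow> 'a set set \<Rightarrow> bool" where
  "is_proper_caterpillar V E \<longleftrightarrow> is_caterpillar V E
     \<and> (\<forall>v\<in>internal V E. \<exists>w\<in>leaves V E. adj E v w)"

definition leaf_count :: "'a set \<Rightarrow> 'a set set \<Rightarrow> 'a \<Rightarrow> nat" where
  "leaf_count V E v = card {w\<in>leaves V E. adj E v w}"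

text \<open>Phi(T): the compositions beta_1...beta_k read along the spine in either direction
  (both orientations of the spine are spines).\<close>
definition Phi :: "'a set \<Rightarrow> 'a set set \<Rightarrow> nat list set" where
  "Phi V E = {map (\<lambda>v. 1 + leaf_count V E v) vs | vs. is_spine V E vs}"

end

theory Submission
  imports Defs
begin

text \<open>
  Let \<open>n = |\<gamma>|\<close>, \<open>m = |\<alpha>| = |\<beta>|\<close>. A composition is determined by its set of partial sums; those of
  \<open>\<alpha> \<circ> \<gamma>\<close> are the \<open>n j + g\<close> with \<open>j < m\<close>, \<open>0 < g < n\<close> a partial sum of \<open>\<gamma>\<close>, which do not depend
  on \<open>\<alpha>\<close>, together with \<open>n\<close> times the partial sums of \<open>\<alpha>\<close>.

  If \<open>s\<close> is a partial sum and neither \<open>nm - s\<close> nor \<open>nm - s + 1\<close> is one, the only way to obtain the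
  component sizes \<open>1, s - 1, nm - s\<close> is to remove the spine edge at \<open>s\<close> and a leaf edge to its left,
  so the coefficient is the number of leaves to the left of the cut, that is, \<open>s\<close> minus the number of
  partial sums in \<open>[1, s]\<close>. Suppose that \<open>\<gamma>\<close> has a partial sum \<open>q\<close> such that neither \<open>n - q\<close> nor
  \<open>n - q + 1\<close> is one. Taking \<open>s = n j + q\<close> for \<open>0 < j < m\<close>, the coefficients give the number of partial
  sums of \<open>\<alpha>\<close> in \<open>[1, j]\<close>, hence \<open>\<alpha>\<close>.

  As \<open>\<gamma>\<close> is not a palindrome, there is a least partial sum \<open>q\<close> for which \<open>n - q\<close> is not one. If
  \<open>n - q + 1\<close> is one, then \<open>q - 1\<close> does the job for the reversed compositions, because partial sums
  of \<open>\<gamma>\<close> are never consecutive: in a proper caterpillar all entries are at least \<open>2\<close>.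
\<close>

section \<open>Partial sums of compositions\<close>

text \<open>Zero and the total both count as partial sums, so that concatenation becomes a union
  with a shifted copy and reversal becomes reflection in the total.\<close>

definition psums :: "nat list \<Rightarrow> nat set" where
  "psums xs = (\<lambda>d. sum_list (take d xs)) ` {..length xs}"

lemma psums_Nil [simp]: "psums [] = {0}"
  by (simp add: psums_def)

lemma psums_Cons [simp]: "psums (x # xs) = insert 0 ((+) x ` psums xs)"
  by (simp add: psums_def atMost_Suc_eq_insert_0 image_image)

lemma zero_in_psums [simp]: "0 \<in> psums xs"
  by (cases xs) auto

lemma sum_in_psums [simp]: "sum_list xs \<in> psums xs"
  by (induction xs) auto

lemma psums_le: "x \<in> psums xs \<Longrightarrow> x \<le> sum_list xs"
  by (induction xs arbitrary: x) auto

lemma psums_append: "psums (xs @ ys) = psums xs \<union> (+) (sum_list xs) ` psums ys"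
proof (induction xs)
  case Nil
  then show ?case by (auto simp: insert_absorb)
next
  case (Cons x xs)
  then show ?case by (simp add: image_Un image_image add.assoc)
qed

lemma psums_rev: "psums (rev xs) = (\<lambda>x. sum_list xs - x) ` psums xs"
proof (induction xs)
  case (Cons x xs)
  have "sum_list xs \<in> (\<lambda>y. sum_list xs - y) ` psums xs"
    by (rule image_eqI[of _ _ 0]) auto
  then show ?case
    using Cons by (auto simp: psums_append image_image sum_list_rev add.commute)
qed simp

text \<open>As the entries are positive, the first entry is the least positive partial sum. Shifting
  back by it gives the partial sums of the tail, to which induction applies.\<close>

lemma psums_inj:
  assumes "\<forall>x\<in>set xs. 0 < x" "\<forall>x\<in>set ys. 0 < x" "psums xs = psums ys" shows "xs = ys"
  using assms
proof (induction xs arbitrary: ys)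
  case Nil
  show ?case
  proof (cases ys)
    case (Cons y zs)
    have "y + 0 \<in> psums (y # zs)" unfolding psums_Cons by (intro insertI2 imageI zero_in_psums)
    moreover have "psums (y # zs) = {0}" using Nil(3) unfolding Cons psums_Nil by (rule sym)
    ultimately have "y = 0" by (simp only: singleton_iff add_0_right)
    then show ?thesis using Nil(2) Cons by simp
  qed simp
next
  case (Cons x xs)
  have "x + 0 \<in> psums (x # xs)" unfolding psums_Cons by (intro insertI2 imageI zero_in_psums)
  then have x: "x \<in> psums ys" "0 < x" using Cons.prems by auto
  then obtain y zs where ys: "ys = y # zs" by (cases ys) auto
  have "y + 0 \<in> psums ys" unfolding ys psums_Cons by (intro insertI2 imageI zero_in_psums)
  then have y: "y \<in> psums (x # xs)" "0 < y" using Cons.prems ys by auto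
  \<comment> \<open>Each head is a positive partial sum of the other list, hence at least the other
    head.\<close>
  have "x = y" using x y ys by fastforce
  have tail: "psums us = {z. x + z \<in> psums (x # us)}" for us
    using x(2) by auto
  have "psums xs = psums zs"
    unfolding tail[of xs] tail[of zs] using Cons.prems(3) by (simp only: ys \<open>x = y\<close>)
  then have "xs = zs" using Cons.IH Cons.prems(1,2) by (simp add: ys)
  then show ?case by (simp add: ys \<open>x = y\<close>)
qed

lemma psums_gap:
  assumes "\<forall>x\<in>set xs. 2 \<le> x" "x \<in> psums xs" "y \<in> psums xs" "x < y" shows "x + 2 \<le> y"
  using assms
proof (induction xs arbitrary: x y)
  case (Cons a xs)
  obtain y' where y: "y = a + y'" "y' \<in> psums xs" using Cons.prems by auto
  show ?case
  proof (cases "x = 0")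
    case True
    then show ?thesis using Cons.prems(1) y by simp
  next
    case False
    then obtain x' where "x = a + x'" "x' \<in> psums xs" using Cons.prems by auto
    then show ?thesis using Cons.IH[of x' y'] Cons.prems y by simp
  qed
qed simp

section \<open>Partial sums of near-concatenations and of \<alpha> \<circ> \<gamma>\<close>

lemma psums_near_concat:
  assumes "xs \<noteq> []" "ys \<noteq> []" "0 < last xs" "0 < hd ys"
  shows "psums (near_concat xs ys)
    = (psums xs - {sum_list xs}) \<union> (+) (sum_list xs) ` (psums ys - {0})"
proof -
  obtain bs l where xs: "xs = bs @ [l]" using assms(1) by (metis rev_exhaust)
  obtain h t where ys: "ys = h # t" using assms(2) by (cases ys) auto
  \<comment> \<open>Merging the two middle entries loses only the junction
    \<open>sum_list xs\<close>. Positivity of \<open>last xs\<close> keeps the junction from being a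
    partial sum of \<open>bs\<close>.\<close>
  have "psums xs - {sum_list xs} = psums bs \<union> {sum_list bs}"
    using assms(3) psums_le[of _ bs] xs by (fastforce simp: psums_append)
  moreover have "psums ys - {0} = (+) h ` psums t" using assms(4) ys by auto
  ultimately show ?thesis
    by (auto simp: near_concat_def xs ys psums_append image_image add.assoc)
qed

lemma near_concat_facts:
  assumes "is_composition xs" "is_composition ys"
  shows "is_composition (near_concat xs ys)" "sum_list (near_concat xs ys) = sum_list xs + sum_list ys"
proof -
  obtain bs l where xs: "xs = bs @ [l]" using assms(1) unfolding is_composition_def by (metis rev_exhaust)
  obtain h t where ys: "ys = h # t" using assms(2) unfolding is_composition_def by (cases ys) auto
  show "is_composition (near_concat xs ys)" "sum_list (near_concat xs ys) = sum_list xs + sum_list ys"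
    using assms by (auto simp: is_composition_def near_concat_def xs ys)
qed

text \<open>Meant for \<open>G\<close> the partial sums of \<gamma> strictly between 0 and
  \<open>n\<close>: consecutive copies of \<gamma> contribute these translates, whichever way the
  copies are joined.\<close>

definition translates :: "nat \<Rightarrow> nat set \<Rightarrow> nat \<Rightarrow> nat set" where
  "translates n G k = {n * j + g | j g. j < k \<and> g \<in> G}"

lemma translates_add: "translates n G (a + b) = translates n G a \<union> (+) (n * a) ` translates n G b"
proof (intro equalityI subsetI)
  fix x assume "x \<in> translates n G (a + b)"
  then obtain j g where x: "x = n * j + g" "j < a + b" "g \<in> G" by (auto simp: translates_def)
  show "x \<in> translates n G a \<union> (+) (n * a) ` translates n G b"
  proof (cases "j < a")
    case True
    then show ?thesis using x by (auto simp: translates_def)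
  next
    case False
    then obtain i where "j = a + i" by (metis le_add_diff_inverse not_le)
    then have "x = n * a + (n * i + g)" "i < b"
      using x by (simp_all add: distrib_left)
    moreover from this have "n * i + g \<in> translates n G b" using x(3) by (auto simp: translates_def)
    ultimately show ?thesis by simp
  qed
next
  fix x assume "x \<in> translates n G a \<union> (+) (n * a) ` translates n G b"
  then consider "x \<in> translates n G a" | j g where "x = n * a + (n * j + g)" "j < b" "g \<in> G"
    by (auto simp: translates_def)
  then show "x \<in> translates n G (a + b)"
  proof cases
    case 1
    then show ?thesis unfolding translates_def using trans_less_add1 by blast
  next
    case 2
    then have "x = n * (a + j) + g" "a + j < a + b" by (simp_all add: distrib_left)
    then show ?thesis using 2(3) unfolding translates_def by blast
  qed
qed

lemma translates_0 [simp]: "translates n G 0 = {}" and translates_1 [simp]: "translates n G (Suc 0) = G"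
  by (auto simp: translates_def)

lemma composition_sum_pos: "is_composition xs \<Longrightarrow> 0 < sum_list xs"
  unfolding is_composition_def by (cases xs) auto

text \<open>Near-concatenation erases every inner junction, so that only the two ends and the
  translates survive. The exponent is \<open>Suc k\<close> because the zeroth near-power is the
  empty list. The claims are proved together, since each step needs the smaller power to be a
  composition.\<close>

lemma near_pow_facts:
  assumes "is_composition \<gamma>"
  shows "is_composition (near_pow \<gamma> (Suc k))" and "sum_list (near_pow \<gamma> (Suc k)) = sum_list \<gamma> * Suc k"
    and "psums (near_pow \<gamma> (Suc k)) = {0, sum_list \<gamma> * Suc k}
      \<union> translates (sum_list \<gamma>) (psums \<gamma> - {0, sum_list \<gamma>}) (Suc k)"
proof (induction k)
  case 0
  {
    case 1
    then show ?case using assms by simp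
  next
    case 2
    then show ?case by simp
  next
    case 3
    then show ?case by auto
  }
next
  case (Suc k)
  note facts = near_concat_facts[OF assms Suc(1)]
  {
    case 1
    then show ?case using facts by simp
  next
    case 2
    then show ?case using facts Suc(2) by simp
  next
    case 3
    let ?n = "sum_list \<gamma>" and ?p = "near_pow \<gamma> (Suc k)"
    let ?G = "psums \<gamma> - {0, ?n}"
    have pos: "0 < ?n" by (rule composition_sum_pos[OF assms])
    have ne: "\<gamma> \<noteq> []" "?p \<noteq> []" "0 < last \<gamma>" "0 < hd ?p"
      using assms Suc(1) by (auto simp only: is_composition_def intro: last_in_set hd_in_set)
    have "0 \<notin> translates ?n ?G (Suc k)" by (auto simp: translates_def)
    then have "psums ?p - {0} = insert (?n * Suc k) (translates ?n ?G (Suc k))"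
      using Suc(3) pos by auto
    moreover have "psums \<gamma> - {?n} = insert 0 ?G" using pos by auto
    moreover have "translates ?n ?G (Suc (Suc k)) = ?G \<union> (+) ?n ` translates ?n ?G (Suc k)"
      using translates_add[of ?n ?G "Suc 0" "Suc k"] by simp
    ultimately show ?case using psums_near_concat[OF ne] by auto
  }
qed

lemma comp_circ_Cons: "comp_circ (a # \<alpha>) \<gamma> = near_pow \<gamma> a @ comp_circ \<alpha> \<gamma>"
  by (simp add: comp_circ_def)

text \<open>Ordinary concatenation keeps the junctions between blocks, which sit at
  \<open>sum_list \<gamma>\<close> times the partial sums of \<alpha>. Only positivity of the
  entries of \<alpha> is assumed because the induction starts at the empty list.\<close>

lemma comp_circ_facts:
  assumes "is_composition \<gamma>" "\<forall>a\<in>set \<alpha>. 0 < a"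
  shows "\<forall>x\<in>set (comp_circ \<alpha> \<gamma>). 0 < x" and "sum_list (comp_circ \<alpha> \<gamma>) = sum_list \<gamma> * sum_list \<alpha>"
    and "psums (comp_circ \<alpha> \<gamma>) = translates (sum_list \<gamma>) (psums \<gamma> - {0, sum_list \<gamma>}) (sum_list \<alpha>)
      \<union> (*) (sum_list \<gamma>) ` psums \<alpha>"
  using assms(2)
proof (induction \<alpha>)
  case Nil
  {
    case 1
    then show ?case by (simp add: comp_circ_def)
  next
    case 2
    then show ?case by (simp add: comp_circ_def)
  next
    case 3
    then show ?case by (simp add: comp_circ_def)
  }
next
  case (Cons a \<alpha>)
  {
    case 1
    then obtain k where "a = Suc k" by (auto simp: gr0_conv_Suc)
    then show ?case using 1 Cons(1) near_pow_facts(1)[OF assms(1), of k]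
      by (auto simp: comp_circ_Cons is_composition_def)
  next
    case 2
    then obtain k where "a = Suc k" by (auto simp: gr0_conv_Suc)
    then show ?case using 2 Cons(2) near_pow_facts(2)[OF assms(1), of k]
      by (simp add: comp_circ_Cons distrib_left)
  next
    case 3
    then obtain k where k: "a = Suc k" by (auto simp: gr0_conv_Suc)
    let ?n = "sum_list \<gamma>"
    let ?G = "psums \<gamma> - {0, ?n}"
    have p: "psums (near_pow \<gamma> a) = {0, ?n * a} \<union> translates ?n ?G a" "sum_list (near_pow \<gamma> a) = ?n * a"
      using near_pow_facts[OF assms(1), of k] k by simp_all
    have c: "psums (comp_circ \<alpha> \<gamma>) = translates ?n ?G (sum_list \<alpha>) \<union> (*) ?n ` psums \<alpha>"
      using Cons 3 by simp
    \<comment> \<open>The right end of the first block is also the left end of the remainder; it is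
      accounted for by the partial sum 0 of the tail.\<close>
    have "?n * a + ?n * 0 \<in> (+) (?n * a) ` (*) ?n ` psums \<alpha>" using zero_in_psums[of \<alpha>] by blast
    then show ?case
      unfolding comp_circ_Cons psums_append p c
      by (auto simp: translates_add image_Un image_image distrib_left)
  }
qed

lemma translates_mem_iff:
  assumes "0 < r" "r < n" "G \<subseteq> {..<n}"
  shows "n * i + r \<in> translates n G m \<longleftrightarrow> i < m \<and> r \<in> G"
proof
  assume "n * i + r \<in> translates n G m"
  then obtain j g where "n * i + r = n * j + g" "j < m" "g \<in> G" by (auto simp: translates_def)
  moreover from this have "g < n" using assms(3) by auto
  \<comment> \<open>Quotient and remainder by \<open>n\<close> are unique.\<close>
  ultimately have "i = j \<and> r = g" using assms(2)
    by (metis add_left_cancel div_mult_self4 div_less add.right_neutral less_nat_zero_code)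
  then show "i < m \<and> r \<in> G" using \<open>j < m\<close> \<open>g \<in> G\<close> by simp
qed (auto simp: translates_def)

text \<open>The part of the partial sums that depends on the entries of \<alpha> consists of
  multiples of \<open>sum_list \<gamma>\<close>. Elsewhere only the size of \<alpha> matters, so
  \<alpha> and \<beta> can be treated alike.\<close>

lemma psums_comp_circ_mem:
  assumes "is_composition \<gamma>" "\<forall>a\<in>set \<alpha>. 0 < a" "0 < r" "r < sum_list \<gamma>"
  shows "sum_list \<gamma> * i + r \<in> psums (comp_circ \<alpha> \<gamma>) \<longleftrightarrow> i < sum_list \<alpha> \<and> r \<in> psums \<gamma>"
proof -
  have "psums \<gamma> - {0, sum_list \<gamma>} \<subseteq> {..<sum_list \<gamma>}" using psums_le by (fastforce simp: le_less)
  moreover have "sum_list \<gamma> * i + r \<noteq> sum_list \<gamma> * x" for x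
    using assms(3,4) by (metis mod_mult_self4 mod_less mod_mult_self1_is_0 less_irrefl)
  ultimately show ?thesis
    using comp_circ_facts(3)[OF assms(1,2)] translates_mem_iff[OF assms(3,4)] assms(3,4) by auto
qed

lemma finite_psums: "finite (psums xs)"
  by (simp add: psums_def)

text \<open>Multiples of \<open>sum_list \<gamma>\<close> and translates are disjoint, and
  \<open>r\<close> is too small to admit a further multiple. The second summand depends on \<alpha>
  only through its size and cancels when \<alpha> and \<beta> are compared.\<close>

lemma card_psums_comp_circ:
  assumes \<gamma>: "is_composition \<gamma>" and \<alpha>: "\<forall>a\<in>set \<alpha>. 0 < a" and r: "r < sum_list \<gamma>"
  shows "card (psums (comp_circ \<alpha> \<gamma>) \<inter> {1..sum_list \<gamma> * j + r}) = card (psums \<alpha> \<inter> {1..j}) +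
    card (translates (sum_list \<gamma>) (psums \<gamma> - {0, sum_list \<gamma>}) (sum_list \<alpha>) \<inter> {1..sum_list \<gamma> * j + r})"
proof -
  let ?n = "sum_list \<gamma>"
  let ?X = "translates ?n (psums \<gamma> - {0, ?n}) (sum_list \<alpha>)"
  have "(*) ?n ` psums \<alpha> \<inter> {1..?n * j + r} = (*) ?n ` (psums \<alpha> \<inter> {1..j})"
  proof (intro equalityI subsetI)
    fix y assume "y \<in> (*) ?n ` psums \<alpha> \<inter> {1..?n * j + r}"
    then obtain x where x: "y = ?n * x" "x \<in> psums \<alpha>" "1 \<le> ?n * x" "?n * x \<le> ?n * j + r"
      by (metis IntE imageE atLeastAtMost_iff)
    have "?n * x < ?n * Suc j" using x(4) r by simp
    then have "x \<le> j" by (metis mult_less_cancel1 less_Suc_eq_le)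
    then show "y \<in> (*) ?n ` (psums \<alpha> \<inter> {1..j})" using x by (auto intro!: imageI)
  next
    fix y assume "y \<in> (*) ?n ` (psums \<alpha> \<inter> {1..j})"
    then show "y \<in> (*) ?n ` psums \<alpha> \<inter> {1..?n * j + r}"
      using composition_sum_pos[OF \<gamma>] by (auto intro: trans_le_add1)
  qed
  then have "psums (comp_circ \<alpha> \<gamma>) \<inter> {1..?n * j + r} = (*) ?n ` (psums \<alpha> \<inter> {1..j}) \<union> (?X \<inter> {1..?n * j + r})"
    using comp_circ_facts(3)[OF \<gamma> \<alpha>] by auto
  moreover have "(*) ?n ` (psums \<alpha> \<inter> {1..j}) \<inter> (?X \<inter> {1..?n * j + r}) = {}"
  proof -
    have "?n * j' + g \<noteq> ?n * x" if "g \<in> psums \<gamma> - {0, ?n}" for g j' x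
    proof -
      have "0 < g" "g < ?n" using that psums_le[of g \<gamma>] by (auto simp: le_less)
      then show ?thesis by (metis mod_mult_self4 mod_less mod_mult_self1_is_0 less_irrefl)
    qed
    note neq = this
    have "?n * x \<notin> ?X" for x
    proof
      assume "?n * x \<in> ?X"
      then obtain j' g where "?n * x = ?n * j' + g" "g \<in> psums \<gamma> - {0, ?n}"
        unfolding translates_def by blast
      then show False using neq[of g j' x] by simp
    qed
    then show ?thesis by blast
  qed
  moreover have "inj_on ((*) ?n) (psums \<alpha> \<inter> {1..j})"
    using composition_sum_pos[OF \<gamma>] by (intro inj_onI) (metis mult_cancel1 less_irrefl)
  ultimately show ?thesis by (simp add: card_Un_disjoint finite_psums card_image)
qed

text \<open>Membership of \<open>x\<close> is the difference of the counts at \<open>x\<close> and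
  \<open>x - 1\<close>. Interior \<open>j\<close> suffice because 0 and the total always belong to
  both sets.\<close>

lemma psums_eqI_card:
  assumes "sum_list \<alpha> = sum_list \<beta>"
    and "\<And>j. 0 < j \<Longrightarrow> j < sum_list \<alpha> \<Longrightarrow> card (psums \<alpha> \<inter> {1..j}) = card (psums \<beta> \<inter> {1..j})"
  shows "psums \<alpha> = psums \<beta>"
proof -
  have step: "card (S \<inter> {1..x}) = card (S \<inter> {1..x - 1}) + (if x \<in> S then 1 else 0)" if "0 < x" for S :: "nat set" and x
  proof -
    have "{1..x} = insert x {1..x - 1}" using that by auto
    then show ?thesis using that by simp
  qed
  have "x \<in> psums \<alpha> \<longleftrightarrow> x \<in> psums \<beta>" for x
  proof -
    consider "x = 0" | "x = sum_list \<alpha>" | "sum_list \<alpha> < x" | "0 < x" "x < sum_list \<alpha>" by linarith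
    then show ?thesis
    proof cases
      case 4
      then have "card (psums \<alpha> \<inter> {1..x - 1}) = card (psums \<beta> \<inter> {1..x - 1})"
        \<comment> \<open>For \<open>x = 1\<close> the assumption does not apply, but both intervals
          are empty.\<close>
        using assms(2)[of "x - 1"] by (cases "x = 1") auto
      then have "(if x \<in> psums \<alpha> then 1 else 0 :: nat) = (if x \<in> psums \<beta> then 1 else 0)"
        using assms(2)[OF 4] step[OF 4(1), of "psums \<alpha>"] step[OF 4(1), of "psums \<beta>"] by linarith
      then show ?thesis by (metis zero_neq_one)
    next
      case 2
      then show ?thesis using sum_in_psums[of \<alpha>] sum_in_psums[of \<beta>] assms(1) by metis
    next
      case 3
      then show ?thesis using psums_le[of x \<alpha>] psums_le[of x \<beta>] assms(1) by linarith
    qed simp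
  qed
  then show ?thesis by blast
qed

text \<open>Compared on partial sums. With \<open>n\<close> and \<open>m\<close> the sizes of
  \<gamma> and \<alpha>, reflection in \<open>n * m\<close> sends \<open>n * j + g\<close> to
  \<open>n * (m - 1 - j) + (n - g)\<close> and acts on multiples of \<open>n\<close> as reflection
  in \<open>m\<close> does on the factors.\<close>

lemma rev_comp_circ:
  assumes "is_composition \<gamma>" "\<forall>a\<in>set \<alpha>. 0 < a"
  shows "rev (comp_circ \<alpha> \<gamma>) = comp_circ (rev \<alpha>) (rev \<gamma>)"
proof (rule psums_inj)
  have \<gamma>': "is_composition (rev \<gamma>)" using assms(1) by (simp add: is_composition_def)
  have \<alpha>': "\<forall>a\<in>set (rev \<alpha>). 0 < a" using assms(2) by simp
  show "\<forall>x\<in>set (rev (comp_circ \<alpha> \<gamma>)). 0 < x" using comp_circ_facts(1)[OF assms] by simp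
  show "\<forall>x\<in>set (comp_circ (rev \<alpha>) (rev \<gamma>)). 0 < x" using comp_circ_facts(1)[OF \<gamma>' \<alpha>'] by simp
  let ?n = "sum_list \<gamma>" and ?m = "sum_list \<alpha>"
  let ?G = "psums \<gamma> - {0, ?n}"
  have G': "psums (rev \<gamma>) - {0, ?n} = (-) ?n ` ?G"
    using psums_le[of _ \<gamma>] by (fastforce simp: psums_rev le_less)
  have "(-) (?n * ?m) ` translates ?n ?G ?m = translates ?n ((-) ?n ` ?G) ?m" (is "?f ` ?L = ?R")
  proof (intro equalityI subsetI)
    have flip: "?n * ?m - (?n * j + g) = ?n * (?m - 1 - j) + (?n - g)" if "j < ?m" "g \<le> ?n" for j g
    proof -
      obtain i where "?m = Suc (j + i)" using \<open>j < ?m\<close> less_imp_Suc_add by blast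
      then show ?thesis using that by (simp add: distrib_left)
    qed
    {
      fix x assume "x \<in> ?f ` ?L"
      then obtain j g where "x = ?n * ?m - (?n * j + g)" "j < ?m" "g \<in> ?G" by (auto simp: translates_def)
      then have "x = ?n * (?m - 1 - j) + (?n - g)" "?m - 1 - j < ?m" "?n - g \<in> (-) ?n ` ?G"
        using flip[of j g] psums_le[of g \<gamma>] by auto
      then show "x \<in> ?R" unfolding translates_def by blast
    next
      fix x assume "x \<in> ?R"
      then obtain j g where x: "x = ?n * j + (?n - g)" "j < ?m" "g \<in> ?G" by (auto simp: translates_def)
      then have "x = ?f (?n * (?m - 1 - j) + g)"
        using flip[of "?m - 1 - j" g] psums_le[of g \<gamma>] by simp
      moreover have "?n * (?m - 1 - j) + g \<in> ?L" using x unfolding translates_def by force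
      ultimately show "x \<in> ?f ` ?L" by blast
    }
  qed
  then show "psums (rev (comp_circ \<alpha> \<gamma>)) = psums (comp_circ (rev \<alpha>) (rev \<gamma>))"
    using comp_circ_facts(2,3)[OF assms] comp_circ_facts(3)[OF \<gamma>' \<alpha>'] G'
    by (simp add: psums_rev image_Un image_image sum_list_rev diff_mult_distrib2)
qed

section \<open>Edge subsets of a proper caterpillar\<close>

lemma reach_trans: "reach A x y \<Longrightarrow> reach A y z \<Longrightarrow> reach A x z"
  unfolding reach_def by simp

lemma reach_sym: "reach A x y \<Longrightarrow> reach A y x"
proof -
  have "symp (adj A)" by (auto simp: symp_def adj_def insert_commute)
  then show "reach A x y \<Longrightarrow> reach A y x"
    unfolding reach_def using symp_rtranclp by (metis sympD)
qed

locale spined_caterpillar =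
  fixes V :: "'a set" and E :: "'a set set" and vs :: "'a list"
  assumes proper: "is_proper_caterpillar V E" and spine: "is_spine V E vs"
begin

lemma finite_V: "finite V" and edges: "edges_ok V E"
  and connected: "u \<in> V \<Longrightarrow> v \<in> V \<Longrightarrow> reach E u v"
  using proper
  unfolding is_proper_caterpillar_def is_caterpillar_def is_tree_def connected_graph_def by auto

lemma distinct_vs: "distinct vs" and set_vs: "set vs = V - leaves V E" and two_le_length: "2 \<le> length vs"
  and adj_vs: "i < length vs \<Longrightarrow> j < length vs \<Longrightarrow> adj E (vs ! i) (vs ! j) \<longleftrightarrow> (i = j + 1 \<or> j = i + 1)"
  using spine unfolding is_spine_def internal_def by auto

lemma adj_V: "adj E u v \<Longrightarrow> u \<in> V \<and> v \<in> V \<and> u \<noteq> v"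
  using edges unfolding edges_ok_def adj_def by (fastforce simp: doubleton_eq_iff)

lemma leaf_neighbour_unique:
  assumes "w \<in> leaves V E" "adj E w u" "adj E w v" shows "u = v"
proof -
  have "card {e\<in>E. w \<in> e} = 1" using assms(1) unfolding leaves_def degree_def by simp
  then obtain e where "{e\<in>E. w \<in> e} = {e}" by (auto simp: card_1_singleton_iff)
  moreover have "{w,u} \<in> {e\<in>E. w \<in> e}" "{w,v} \<in> {e\<in>E. w \<in> e}"
    using assms(2,3) unfolding adj_def by simp_all
  ultimately have "{w,u} = {w,v}" by (metis singletonD)
  then show ?thesis by (metis doubleton_eq_iff)
qed

lemma nth_in_V: "i < length vs \<Longrightarrow> vs ! i \<in> V" and nth_not_leaf: "i < length vs \<Longrightarrow> vs ! i \<notin> leaves V E"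
  using set_vs nth_mem by blast+

text \<open>Two adjacent leaves would form a whole component, yet the spine vertex
  \<open>vs ! 0\<close> is reachable from every vertex.\<close>

lemma leaf_neighbour_internal:
  assumes "w \<in> leaves V E" "adj E w v" shows "v \<in> set vs"
proof (rule ccontr)
  assume "v \<notin> set vs"
  then have v: "v \<in> leaves V E" using adj_V[OF assms(2)] set_vs by auto
  have vw: "adj E v w" using assms(2) by (auto simp: adj_def insert_commute)
  have "0 < length vs" using two_le_length by linarith
  then have "vs ! 0 \<in> V" "vs ! 0 \<notin> leaves V E" using nth_in_V nth_not_leaf by auto
  have "reach E w (vs ! 0)"
    using connected \<open>vs ! 0 \<in> V\<close> adj_V[OF assms(2)] by auto
  then have "vs ! 0 = w \<or> vs ! 0 = v"
    unfolding reach_def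
  proof (induction rule: rtranclp_induct)
    case (step y z)
    then show ?case using leaf_neighbour_unique assms v vw by blast
  qed simp
  then show False using \<open>vs ! 0 \<notin> leaves V E\<close> v assms(1) by auto
qed

lemma leaf_has_neighbour:
  assumes "w \<in> leaves V E" shows "\<exists>i<length vs. adj E w (vs ! i)"
proof -
  have "card {e\<in>E. w \<in> e} = 1" using assms(1) unfolding leaves_def degree_def by simp
  then obtain e where "e \<in> E" "w \<in> e" by (auto simp: card_1_singleton_iff)
  then obtain a b where "e = {a,b}" "a \<noteq> b" using edges unfolding edges_ok_def by blast
  then have "adj E w a \<or> adj E w b"
    using \<open>e \<in> E\<close> \<open>w \<in> e\<close> unfolding adj_def by (auto simp: insert_commute)
  then obtain v where "adj E w v" by blast
  then show ?thesis using leaf_neighbour_internal[OF assms] by (metis in_set_conv_nth)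
qed

section \<open>Position of a vertex along the spine\<close>

definition attached :: "'a \<Rightarrow> nat \<Rightarrow> bool" where
  "attached x i \<longleftrightarrow> i < length vs \<and> (vs ! i = x \<or> x \<in> leaves V E \<and> adj E x (vs ! i))"

text \<open>A leaf takes the position of its spine neighbour, so that removing a spine edge
  separates small positions from large ones.\<close>

definition idx :: "'a \<Rightarrow> nat" where
  "idx x = (THE i. attached x i)"

lemma attached_unique: "attached x i \<Longrightarrow> attached x j \<Longrightarrow> i = j"
  unfolding attached_def using nth_not_leaf leaf_neighbour_unique distinct_vs nth_eq_iff_index_eq by metis

lemma idx_eq: "attached x i \<Longrightarrow> idx x = i"
  unfolding idx_def using attached_unique by blast

lemma attached_idx: assumes "x \<in> V" shows "attached x (idx x)"
proof -
  have "\<exists>i. attached x i"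
    using assms leaf_has_neighbour set_vs unfolding attached_def by (metis DiffI in_set_conv_nth)
  then show ?thesis using idx_eq by auto
qed

lemma idx_less: "x \<in> V \<Longrightarrow> idx x < length vs"
  using attached_idx unfolding attached_def by blast

lemma idx_nth: "i < length vs \<Longrightarrow> idx (vs ! i) = i"
  by (rule idx_eq) (simp add: attached_def)

lemma leaf_in_V: "w \<in> leaves V E \<Longrightarrow> w \<in> V"
  unfolding leaves_def by simp

lemma adj_idx: "w \<in> leaves V E \<Longrightarrow> adj E w (vs ! idx w)"
  using attached_idx[of w] nth_not_leaf[of "idx w"] leaf_in_V[of w] by (auto simp: attached_def)

lemma internal_nth_idx: "x \<in> V \<Longrightarrow> x \<notin> leaves V E \<Longrightarrow> vs ! idx x = x"
  using attached_idx[of x] unfolding attached_def by auto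

section \<open>Leaf edges and spine edges\<close>

definition leaf_edge :: "'a \<Rightarrow> 'a set" where
  "leaf_edge w = {w, vs ! idx w}"

text \<open>The index counts the spine vertices to the left of the edge and thus ranges over
  \<open>0 < d < length vs\<close>.\<close>

definition spine_edge :: "nat \<Rightarrow> 'a set" where
  "spine_edge d = {vs ! (d - 1), vs ! d}"

lemma leaf_edge_in: "w \<in> leaves V E \<Longrightarrow> leaf_edge w \<in> E"
  using adj_idx unfolding leaf_edge_def adj_def by auto

lemma spine_edge_in: "0 < d \<Longrightarrow> d < length vs \<Longrightarrow> spine_edge d \<in> E"
  using adj_vs[of "d-1" d] unfolding spine_edge_def adj_def by auto

lemma adj_cases:
  assumes "adj E x y"
  obtains (leaf1) "x \<in> leaves V E" "{x,y} = leaf_edge x" "y = vs ! idx x"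
    | (leaf2) "y \<in> leaves V E" "{x,y} = leaf_edge y" "x = vs ! idx y"
    | (up) d where "0 < d" "d < length vs" "x = vs ! (d-1)" "y = vs ! d"
    | (down) d where "0 < d" "d < length vs" "x = vs ! d" "y = vs ! (d-1)"
proof -
  consider (1) "x \<in> leaves V E" | (2) "y \<in> leaves V E" | (3) "x \<in> set vs" "y \<in> set vs"
    using adj_V[OF assms] set_vs by auto
  then show ?thesis
  proof cases
    case 1
    then show ?thesis using leaf_neighbour_unique[OF 1 assms adj_idx[OF 1]] leaf1 unfolding leaf_edge_def by auto
  next
    case 2
    have "adj E y x" using assms by (auto simp: adj_def insert_commute)
    then have x: "x = vs ! idx y" by (rule leaf_neighbour_unique[OF 2 _ adj_idx[OF 2]])
    then have "{x,y} = leaf_edge y" by (auto simp: leaf_edge_def)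
    then show ?thesis using 2 x leaf2 by simp
  next
    case 3
    then obtain i j where ij: "i < length vs" "x = vs ! i" "j < length vs" "y = vs ! j"
      by (metis in_set_conv_nth)
    then have "i = j + 1 \<or> j = i + 1" using adj_vs[of i j] assms by simp
    then show ?thesis
    proof
      assume "i = j + 1" then show ?thesis using ij by (intro down[of i]) (simp_all (no_asm_simp))
    next
      assume "j = i + 1" then show ?thesis using ij by (intro up[of j]) (simp_all (no_asm_simp))
    qed
  qed
qed

lemma edge_cases:
  assumes "e \<in> E"
  obtains (leaf) w where "w \<in> leaves V E" "e = leaf_edge w"
    | (spine) d where "0 < d" "d < length vs" "e = spine_edge d"
proof -
  obtain x y where "e = {x,y}" "x \<noteq> y" using assms edges unfolding edges_ok_def by blast
  then have xy: "e = {x,y}" "adj E x y" using assms by (simp_all add: adj_def)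
  from xy(2) show ?thesis
  proof (cases rule: adj_cases)
    case (up d)
    then show ?thesis using xy(1) by (intro spine[of d]) (simp_all add: spine_edge_def)
  next
    case (down d)
    then show ?thesis using xy(1) by (intro spine[of d]) (auto simp: spine_edge_def)
  qed (use xy(1) leaf in simp_all)
qed

lemma leaf_edge_inj: "w \<in> leaves V E \<Longrightarrow> w' \<in> leaves V E \<Longrightarrow> leaf_edge w = leaf_edge w' \<Longrightarrow> w = w'"
  using nth_not_leaf[of "idx w"] idx_less[of w] leaf_in_V[of w] by (auto simp: leaf_edge_def doubleton_eq_iff)

lemma spine_edge_inj:
  assumes "0 < d" "d < length vs" "0 < d'" "d' < length vs" "spine_edge d = spine_edge d'" shows "d = d'"
proof -
  have "idx ` spine_edge d = {d-1,d}" if "0 < d" "d < length vs" for d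
    using that idx_nth[of d] idx_nth[of "d-1"] unfolding spine_edge_def by simp
  then have "{d-1,d} = {d'-1,d'}" using assms by metis
  then show ?thesis using assms by (auto simp: doubleton_eq_iff)
qed

lemma leaf_edge_neq_spine_edge: "w \<in> leaves V E \<Longrightarrow> 0 < d \<Longrightarrow> d < length vs \<Longrightarrow> leaf_edge w \<noteq> spine_edge d"
  unfolding leaf_edge_def spine_edge_def using nth_not_leaf[of d] nth_not_leaf[of "d-1"]
  by (auto simp: doubleton_eq_iff)

section \<open>Components left by an edge subset\<close>

definition cut_leaves :: "'a set set \<Rightarrow> 'a set" where
  "cut_leaves A = {w \<in> leaves V E. leaf_edge w \<notin> A}"

definition cuts :: "'a set set \<Rightarrow> nat set" where
  "cuts A = {d. 0 < d \<and> d < length vs \<and> spine_edge d \<notin> A}"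

text \<open>Describes lying in a common component for distinct vertices. It fails to be reflexive at
  cut leaves, hence the alternative \<open>x = y\<close> in \<open>reach_iff\<close>.\<close>

definition linked :: "'a set set \<Rightarrow> 'a \<Rightarrow> 'a \<Rightarrow> bool" where
  "linked A x y \<longleftrightarrow> x \<notin> cut_leaves A \<and> y \<notin> cut_leaves A \<and> (\<forall>d\<in>cuts A. idx x < d \<longleftrightarrow> idx y < d)"

lemma adj_imp_linked:
  assumes "A \<subseteq> E" "adj A x y" shows "linked A x y"
proof -
  have xyA: "{x,y} \<in> A" and "adj E x y" using assms by (auto simp: adj_def)
  from this(2) show ?thesis
  proof (cases rule: adj_cases)
    case leaf1
    then show ?thesis using xyA leaf_in_V idx_less idx_nth nth_not_leaf
      by (auto simp: linked_def cut_leaves_def)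
  next
    case leaf2
    then show ?thesis using xyA leaf_in_V idx_less idx_nth nth_not_leaf
      by (auto simp: linked_def cut_leaves_def)
  next
    case (up d)
    then have "spine_edge d \<in> A" using xyA by (simp add: spine_edge_def)
    then have "d \<notin> cuts A" by (simp add: cuts_def)
    \<comment> \<open>Only a cut at \<open>d\<close> itself could separate the positions
      \<open>d - 1\<close> and \<open>d\<close>.\<close>
    then have "d - 1 < e \<longleftrightarrow> d < e" if "e \<in> cuts A" for e
      using that \<open>0 < d\<close> by (cases "e = d") auto
    moreover have "idx x = d - 1" "idx y = d" using up idx_nth[of d] idx_nth[of "d-1"] by simp_all
    ultimately show ?thesis using up nth_not_leaf[of d] nth_not_leaf[of "d-1"]
      by (simp add: linked_def cut_leaves_def)
  next
    case (down d)
    then have "spine_edge d \<in> A" using xyA by (simp add: spine_edge_def insert_commute)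
    then have "d \<notin> cuts A" by (simp add: cuts_def)
    then have "d - 1 < e \<longleftrightarrow> d < e" if "e \<in> cuts A" for e
      using that \<open>0 < d\<close> by (cases "e = d") auto
    moreover have "idx y = d - 1" "idx x = d" using down idx_nth[of d] idx_nth[of "d-1"] by simp_all
    ultimately show ?thesis using down nth_not_leaf[of d] nth_not_leaf[of "d-1"]
      by (simp add: linked_def cut_leaves_def)
  qed
qed

lemma reach_foot:
  assumes "x \<in> V" "x \<notin> cut_leaves A" shows "reach A x (vs ! idx x)"
proof (cases "x \<in> leaves V E")
  case True
  then have "leaf_edge x \<in> A" using assms by (auto simp: cut_leaves_def)
  then have "adj A x (vs ! idx x)" using adj_idx[OF True] by (auto simp: adj_def leaf_edge_def)
  then show ?thesis by (simp add: reach_def)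
next
  case False
  then show ?thesis using assms internal_nth_idx by (simp add: reach_def)
qed

lemma reach_along_spine:
  assumes "i \<le> j" "j < length vs" "\<forall>d\<in>cuts A. \<not> (i < d \<and> d \<le> j)"
  shows "reach A (vs ! i) (vs ! j)"
  using assms
proof (induction j rule: dec_induct)
  case base
  then show ?case by (simp add: reach_def)
next
  case (step n)
  then have "Suc n \<notin> cuts A" by auto
  then have "spine_edge (Suc n) \<in> A" using step.prems by (auto simp: cuts_def)
  moreover have "vs ! n \<noteq> vs ! Suc n" using distinct_vs step.prems nth_eq_iff_index_eq by fastforce
  ultimately have "adj A (vs ! n) (vs ! Suc n)" by (auto simp: adj_def spine_edge_def)
  moreover have "\<forall>d\<in>cuts A. \<not> (i < d \<and> d \<le> n)" using step.prems(2) by auto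
  then have "reach A (vs ! i) (vs ! n)" using step.IH step.prems(1) by simp
  ultimately show ?case by (simp add: reach_def)
qed

text \<open>Each adjacency preserves \<open>linked\<close>, which is transitive. Conversely one
  walks from \<open>x\<close> to its spine vertex, along the uncut stretch of the spine, and out to
  \<open>y\<close>; symmetry reduces this to \<open>idx x \<le> idx y\<close>.\<close>

lemma reach_iff:
  assumes "A \<subseteq> E" "x \<in> V" "y \<in> V"
  shows "reach A x y \<longleftrightarrow> x = y \<or> linked A x y"
proof
  assume "reach A x y"
  then show "x = y \<or> linked A x y" unfolding reach_def
  proof (induction rule: rtranclp_induct)
    case (step y z)
    then show ?case using adj_imp_linked[OF assms(1) step(2)] by (auto simp: linked_def)
  qed simp
next
  have *: "reach A x y" if "x \<in> V" "y \<in> V" "linked A x y" "idx x \<le> idx y" for x y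
  proof -
    have "reach A (vs ! idx x) (vs ! idx y)"
    proof (rule reach_along_spine)
      show "\<forall>d\<in>cuts A. \<not> (idx x < d \<and> d \<le> idx y)"
        using that by (auto simp: linked_def)
    qed (use that idx_less in auto)
    moreover have "reach A x (vs ! idx x)" "reach A y (vs ! idx y)"
      using that by (simp_all add: linked_def reach_foot)
    then have "reach A x (vs ! idx x)" "reach A (vs ! idx y) y"
      using reach_sym[of A y] by simp_all
    ultimately show ?thesis using reach_trans by metis
  qed
  assume "x = y \<or> linked A x y"
  then show "reach A x y"
  proof
    assume xy: "linked A x y"
    then have yx: "linked A y x" by (simp add: linked_def)
    show ?thesis
    proof (cases "idx x \<le> idx y")
      case True
      then show ?thesis using * xy assms by simp
    next
      case False
      then have "reach A y x" using * yx assms by simp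
      then show ?thesis by (rule reach_sym)
    qed
  qed (simp add: reach_def)
qed

lemma component_cut_leaf: "A \<subseteq> E \<Longrightarrow> w \<in> cut_leaves A \<Longrightarrow> component V A w = {w}"
  unfolding component_def using reach_iff[of A w] leaf_in_V by (auto simp: linked_def cut_leaves_def)

lemma component_eq: "A \<subseteq> E \<Longrightarrow> x \<in> V \<Longrightarrow> x \<notin> cut_leaves A \<Longrightarrow>
  component V A x = {y \<in> V. y \<notin> cut_leaves A \<and> (\<forall>d\<in>cuts A. idx x < d \<longleftrightarrow> idx y < d)}"
  unfolding component_def using reach_iff[of A x] by (auto simp: linked_def)

text \<open>Every edge is a leaf edge or a spine edge, so an edge subset can be recovered from its
  cut leaves and cuts.\<close>

lemma removed_set:
  assumes "A \<subseteq> E" shows "A = E - leaf_edge ` cut_leaves A - spine_edge ` cuts A"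
proof (intro equalityI subsetI)
  fix e assume "e \<in> A"
  then show "e \<in> E - leaf_edge ` cut_leaves A - spine_edge ` cuts A"
    using assms by (auto simp: cut_leaves_def cuts_def)
next
  fix e assume e: "e \<in> E - leaf_edge ` cut_leaves A - spine_edge ` cuts A"
  then have "e \<in> E" by blast
  then show "e \<in> A"
    by (cases rule: edge_cases) (use e in \<open>auto simp: cut_leaves_def cuts_def\<close>)
qed

section \<open>Vertex and leaf counts along the spine\<close>

definition prefix_weight :: "nat \<Rightarrow> nat" where
  "prefix_weight d = sum_list (take d (map (\<lambda>v. 1 + leaf_count V E v) vs))"

lemma attached_card:
  assumes "i < length vs" shows "card {x \<in> V. idx x = i} = 1 + leaf_count V E (vs ! i)"
proof -
  have "{x \<in> V. idx x = i} = insert (vs ! i) {w \<in> leaves V E. adj E (vs ! i) w}"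
  proof (intro equalityI subsetI)
    fix x assume "x \<in> {x \<in> V. idx x = i}"
    then have "attached x i" using attached_idx by auto
    then show "x \<in> insert (vs ! i) {w \<in> leaves V E. adj E (vs ! i) w}"
      unfolding attached_def adj_def by (auto simp: insert_commute)
  next
    fix x assume "x \<in> insert (vs ! i) {w \<in> leaves V E. adj E (vs ! i) w}"
    then have "attached x i" "x \<in> V" using assms nth_in_V[OF assms] leaf_in_V[of x]
      unfolding attached_def adj_def by (auto simp: insert_commute)
    then show "x \<in> {x \<in> V. idx x = i}" using idx_eq by auto
  qed
  moreover have "finite {w \<in> leaves V E. adj E (vs ! i) w}"
    using finite_V leaf_in_V by (auto intro: finite_subset)
  ultimately show ?thesis using nth_not_leaf[OF assms] by (simp add: leaf_count_def)
qed

lemma prefix_card: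
  assumes "d \<le> length vs" shows "card {x \<in> V. idx x < d} = prefix_weight d"
  using assms
proof (induction d)
  case (Suc d)
  have "{x \<in> V. idx x < Suc d} = {x \<in> V. idx x < d} \<union> {x \<in> V. idx x = d}" by auto
  then have "card {x \<in> V. idx x < Suc d} = card {x \<in> V. idx x < d} + card {x \<in> V. idx x = d}"
    using finite_V by (subst card_Un_disjoint[symmetric]) auto
  also have "\<dots> = prefix_weight d + (1 + leaf_count V E (vs ! d))"
    using Suc attached_card by auto
  also have "\<dots> = prefix_weight (Suc d)"
    using Suc by (simp add: prefix_weight_def take_Suc_conv_app_nth)
  finally show ?case .
qed (simp add: prefix_weight_def)

text \<open>Of the vertices left of the cut, exactly \<open>d\<close> are on the spine. The
  remaining ones are the possible choices of a leaf edge in the coefficient computed later.\<close>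

lemma prefix_leaves_card:
  assumes "d \<le> length vs" shows "card {w \<in> leaves V E. idx w < d} + d = prefix_weight d"
proof -
  have "{x \<in> V. idx x < d} = {w \<in> leaves V E. idx w < d} \<union> (\<lambda>i. vs ! i) ` {..<d}"
  proof (intro equalityI subsetI)
    fix x assume "x \<in> {x \<in> V. idx x < d}"
    then show "x \<in> {w \<in> leaves V E. idx w < d} \<union> (\<lambda>i. vs ! i) ` {..<d}"
      using internal_nth_idx[of x] by (cases "x \<in> leaves V E") (auto intro: rev_image_eqI[of "idx x"])
  next
    fix x assume "x \<in> {w \<in> leaves V E. idx w < d} \<union> (\<lambda>i. vs ! i) ` {..<d}"
    then show "x \<in> {x \<in> V. idx x < d}"
      using assms by (auto simp: leaf_in_V nth_in_V idx_nth)
  qed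
  moreover have "finite {w \<in> leaves V E. idx w < d}"
    using finite_V leaf_in_V by (auto intro: finite_subset)
  moreover have "card ((\<lambda>i. vs ! i) ` {..<d}) = d"
    using assms distinct_vs by (subst card_image) (auto simp: inj_on_def nth_eq_iff_index_eq)
  moreover have "{w \<in> leaves V E. idx w < d} \<inter> (\<lambda>i. vs ! i) ` {..<d} = {}"
    using assms nth_not_leaf by auto
  ultimately have "card {x \<in> V. idx x < d} = card {w \<in> leaves V E. idx w < d} + d"
    by (simp add: card_Un_disjoint)
  then show ?thesis using prefix_card[OF assms] by simp
qed

lemma prefix_weight_all: "prefix_weight (length vs) = card V"
proof -
  have "{x \<in> V. idx x < length vs} = V" using idx_less by auto
  then show ?thesis using prefix_card[of "length vs"] by simp
qed

lemma prefix_weight_mono: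
  assumes "i < j" "j \<le> length vs" shows "prefix_weight i < prefix_weight j"
proof -
  have "{x \<in> V. idx x < i} \<subset> {x \<in> V. idx x < j}"
  proof
    show "{x \<in> V. idx x < i} \<noteq> {x \<in> V. idx x < j}"
      using assms nth_in_V[of i] idx_nth[of i] by force
  qed (use assms in auto)
  then have "card {x \<in> V. idx x < i} < card {x \<in> V. idx x < j}"
    using finite_V by (intro psubset_card_mono) auto
  then show ?thesis using assms by (simp add: prefix_card)
qed

lemma has_leaf: "i < length vs \<Longrightarrow> \<exists>w\<in>leaves V E. idx w = i"
proof -
  assume i: "i < length vs"
  then obtain w where w: "w \<in> leaves V E" "adj E (vs ! i) w"
    using proper nth_in_V nth_not_leaf unfolding is_proper_caterpillar_def internal_def by blast
  then have "attached w i" using i by (auto simp: attached_def adj_def insert_commute)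
  then show ?thesis using w idx_eq by auto
qed

section \<open>Partitions with a single part 1 among three parts, and their coefficients\<close>

lemma comp_partition_cut:
  assumes A: "A \<subseteq> E" and W: "cut_leaves A = {w}" and D: "cuts A = {d}"
  shows "comp_partition V A =
    (if idx w < d then {#1, prefix_weight d - 1, card V - prefix_weight d#}
     else {#1, prefix_weight d, card V - prefix_weight d - 1#})"
proof -
  have d: "0 < d" "d < length vs" using D by (auto simp: cuts_def)
  have w: "w \<in> leaves V E" "w \<in> V" using W leaf_in_V by (auto simp: cut_leaves_def)
  \<comment> \<open>The cut leaf is a component of its own and is missing from the side on which it
    hangs.\<close>
  define L where "L = {x \<in> V. idx x < d} - {w}"
  define R where "R = {x \<in> V. \<not> idx x < d} - {w}"
  have comp: "component V A x = (if x = w then {w} else if idx x < d then L else R)" if "x \<in> V" for x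
    using component_eq[OF A that] component_cut_leaf[OF A, of w] W D by (auto simp: L_def R_def)
  have "0 < length vs" using d by linarith
  \<comment> \<open>The spine vertices \<open>vs ! 0\<close> and \<open>vs ! d\<close> represent the
    two sides; not being leaves, they also distinguish both sides from \<open>{w}\<close>.\<close>
  then have L: "vs ! 0 \<in> L"
    using nth_in_V[of 0] idx_nth[of 0] nth_not_leaf[of 0] w d unfolding L_def by (metis (mono_tags, lifting) DiffI mem_Collect_eq singletonD)
  have R: "vs ! d \<in> R"
    using nth_in_V[of d] idx_nth[of d] nth_not_leaf[of d] w d unfolding R_def
    by (metis (mono_tags, lifting) DiffI mem_Collect_eq singletonD order_less_irrefl)
  have "component V A ` V = {{w}, L, R}"
  proof (intro equalityI subsetI)
    fix C assume "C \<in> {{w}, L, R}"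
    then consider "C = component V A w" | "C = component V A (vs ! 0)" | "C = component V A (vs ! d)"
      using comp w L R unfolding L_def R_def by auto
    then show "C \<in> component V A ` V" using w L R unfolding L_def R_def by cases auto
  qed (use comp in auto)
  moreover have "{w} \<noteq> L" "{w} \<noteq> R" "L \<noteq> R"
    using L R unfolding L_def R_def by auto
  ultimately have "comp_partition V A = {#1, card L, card R#}"
    by (simp add: comp_partition_def)
  moreover have "card L = (if idx w < d then prefix_weight d - 1 else prefix_weight d)"
    using prefix_card[of d] d w finite_V unfolding L_def by auto
  moreover have "card {x \<in> V. \<not> idx x < d} = card V - prefix_weight d"
  proof -
    have "{x \<in> V. \<not> idx x < d} = V - {x \<in> V. idx x < d}" by auto
    then show ?thesis using prefix_card[of d] d finite_V by (simp add: card_Diff_subset)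
  qed
  then have "card R = (if idx w < d then card V - prefix_weight d else card V - prefix_weight d - 1)"
    using w finite_V unfolding R_def by auto
  ultimately show ?thesis by auto
qed

lemma finite_components: "finite (component V A ` V)"
  using finite_V by simp

lemma count_one: "count (comp_partition V A) 1 = card {C \<in> component V A ` V. card C = 1}"
proof -
  have "count (comp_partition V A) 1 = card (card -` {1} \<inter> component V A ` V)"
    unfolding comp_partition_def count_image_mset using finite_components[of A]
    by simp
  also have "card -` {1} \<inter> component V A ` V = {C \<in> component V A ` V. card C = 1}" by auto
  finally show ?thesis .
qed

text \<open>Without cut leaves every component contains a spine vertex together with a leaf attached
  to it, by properness, and so is no singleton. Each cut leaf, in turn, is a singleton component, so
  there is only one.\<close>

lemma single_cut_leaf:
  assumes A: "A \<subseteq> E" and one: "count (comp_partition V A) 1 = 1"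
  obtains w where "cut_leaves A = {w}"
proof -
  have "card {C \<in> component V A ` V. card C = 1} = 1" using one count_one by metis
  then obtain C where C: "{C \<in> component V A ` V. card C = 1} = {C}" by (auto simp: card_1_singleton_iff)
  have "cut_leaves A \<noteq> {}"
  proof
    assume W: "cut_leaves A = {}"
    obtain x where x: "x \<in> V" "C = component V A x" "card C = 1" using C by blast
    obtain w where w: "w \<in> leaves V E" "idx w = idx x" using has_leaf[OF idx_less[OF x(1)]] by blast
    have "w \<in> C" "vs ! idx x \<in> C"
      using W w x(2) component_eq[OF A x(1)] leaf_in_V[of w] nth_in_V[OF idx_less[OF x(1)]]
        idx_nth[OF idx_less[OF x(1)]] by auto
    moreover have "w \<noteq> vs ! idx x" using w nth_not_leaf[OF idx_less[OF x(1)]] by metis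
    ultimately show False using x(3) by (auto simp: card_1_singleton_iff)
  qed
  moreover have "C = {w}" if "w \<in> cut_leaves A" for w
  proof -
    have "w \<in> V" using that leaf_in_V by (simp add: cut_leaves_def)
    then have "{w} \<in> component V A ` V" using component_cut_leaf[OF A that] by (metis image_eqI)
    then have "{w} \<in> {C \<in> component V A ` V. card C = 1}" by simp
    then show ?thesis unfolding C by simp
  qed
  ultimately obtain w where "w \<in> cut_leaves A" "\<And>w'. w' \<in> cut_leaves A \<Longrightarrow> w' = w"
    by (metis all_not_in_conv singleton_inject)
  then have "cut_leaves A = {w}" by blast
  then show ?thesis by (rule that)
qed

text \<open>Besides the cut leaf, no cut leaves at most one component, while two cuts
  \<open>e < d\<close> give at least three, represented by the spine positions 0, \<open>e\<close>
  and \<open>d\<close>.\<close>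

lemma single_cut:
  assumes A: "A \<subseteq> E" and W: "cut_leaves A = {w}" and size: "size (comp_partition V A) = 3"
  obtains d where "cuts A = {d}"
proof -
  have card3: "card (component V A ` V) = 3" using size by (simp add: comp_partition_def)
  have w: "w \<in> leaves V E" "w \<in> V" using W leaf_in_V by (auto simp: cut_leaves_def)
  have "cuts A \<noteq> {}"
  proof
    assume "cuts A = {}"
    then have "component V A ` V \<subseteq> {{w}, V - {w}}"
      using component_eq[OF A] component_cut_leaf[OF A, of w] W by auto
    then have "card (component V A ` V) \<le> card {{w}, V - {w}}" by (rule card_mono[rotated]) simp
    also have "\<dots> \<le> 2" by (simp add: card_insert_if)
    finally show False using card3 by simp
  qed
  moreover have "\<not> e < d" if de: "d \<in> cuts A" "e \<in> cuts A" for d e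
  proof
    assume less: "e < d"
    have b: "0 < e" "d < length vs" using de by (auto simp: cuts_def)
    define f where "f = (\<lambda>i. component V A (vs ! i))"
    have comp: "vs ! j \<in> f i \<longleftrightarrow> (\<forall>d\<in>cuts A. i < d \<longleftrightarrow> j < d)" if "i < length vs" "j < length vs" for i j
    proof -
      have "vs ! i \<noteq> w" "vs ! j \<noteq> w" using that nth_not_leaf w by blast+
      then show ?thesis
        unfolding f_def using that component_eq[OF A, of "vs ! i"] nth_in_V W by (simp add: idx_nth)
    qed
    have self: "vs ! i \<in> f i" if "i < length vs" for i using comp that by blast
    have neq: "{w} \<noteq> f i" if "i < length vs" for i
      using self[OF that] nth_not_leaf[OF that] w by auto
    have "f 0 \<noteq> f e" "f 0 \<noteq> f d" "f e \<noteq> f d"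
      using self[of 0] self[of e] self[of d] comp[of e 0] comp[of d 0] comp[of d e] de less b by force+
    moreover have "{w} \<noteq> f 0" "{w} \<noteq> f e" "{w} \<noteq> f d" by (rule neq; use less b in linarith)+
    ultimately have "card {{w}, f 0, f e, f d} = 4" by (simp add: card_insert_if)
    moreover have "{{w}, f 0, f e, f d} \<subseteq> component V A ` V"
      using component_cut_leaf[OF A, of w] W w b less nth_in_V unfolding f_def by fastforce
    ultimately have "4 \<le> card (component V A ` V)" using card_mono[OF finite_components] by metis
    then show False using card3 by simp
  qed
  ultimately obtain d where "d \<in> cuts A" "\<And>e. e \<in> cuts A \<Longrightarrow> e = d" by (metis all_not_in_conv nat_neq_iff)
  then have "cuts A = {d}" by blast
  then show ?thesis by (rule that)
qed

text \<open>The subsets counted remove \<open>spine_edge d\<close> and one leaf edge left of it, so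
  their number is \<open>prefix_weight d - d\<close>; the equation is additive to avoid
  subtraction.\<close>

lemma count_U_poly:
  assumes d: "0 < d" "d < length vs" "prefix_weight d = a + 1"
    and ab: "2 \<le> a" "2 \<le> b" "a + b + 1 = card V"
    and free: "\<And>e. e < length vs \<Longrightarrow> prefix_weight e \<notin> {a, b, b + 1}"
  shows "count (U_poly V E) {#1, a, b#} + d = a + 1"
proof -
  define F where "F = (\<lambda>w. E - {leaf_edge w, spine_edge d})"
  have "finite E" using finite_V edges unfolding edges_ok_def
    by (intro finite_subset[of E "Pow V"]) auto
  have cutF: "cut_leaves (F w) = {w}" "cuts (F w) = {d}" "F w \<subseteq> E" if "w \<in> leaves V E" for w
  proof -
    show "cut_leaves (F w) = {w}"
      unfolding F_def cut_leaves_def using that leaf_edge_in leaf_edge_inj leaf_edge_neq_spine_edge d by auto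
    show "cuts (F w) = {d}"
      unfolding F_def cuts_def using that spine_edge_in spine_edge_inj leaf_edge_neq_spine_edge[OF that] d
      by (auto; metis)
  qed (auto simp: F_def)
  have "{A \<in> Pow E. comp_partition V A = {#1, a, b#}} = F ` {w \<in> leaves V E. idx w < d}" (is "?L = ?R")
  proof (intro equalityI subsetI)
    fix A assume "A \<in> ?L"
    then have A: "A \<subseteq> E" "comp_partition V A = {#1, a, b#}" by auto
    \<comment> \<open>As \<open>a\<close> and \<open>b\<close> are at least 2, the part 1 occurs
      only once.\<close>
    then have "count (comp_partition V A) 1 = 1" using ab by simp
    then obtain w where W: "cut_leaves A = {w}" using single_cut_leaf A by metis
    have "size (comp_partition V A) = 3" using A by simp
    then obtain e where D: "cuts A = {e}" using single_cut A W by metis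
    have e: "0 < e" "e < length vs" using D by (auto simp: cuts_def)
    have pe: "prefix_weight e < card V" "0 < prefix_weight e"
      using e prefix_weight_mono[of e "length vs"] prefix_weight_mono[of 0 e] prefix_weight_all by auto
    \<comment> \<open>A leaf left of the cut forces \<open>prefix_weight e\<close> to be
      \<open>a + 1\<close> or \<open>b + 1\<close>, a leaf right of it forces \<open>a\<close> or
      \<open>b\<close>. All but \<open>a + 1\<close> are excluded by \<open>free\<close>.\<close>
    have "idx w < e \<and> prefix_weight e = a + 1"
    proof (cases "idx w < e")
      case True
      then have "{#prefix_weight e - 1, card V - prefix_weight e#} = {#a, b#}"
        using comp_partition_cut[OF A(1) W D] A(2) by simp
      then have "prefix_weight e - 1 \<in># {#a, b#}" by (metis union_single_eq_member)
      then have "prefix_weight e - 1 = a \<or> prefix_weight e - 1 = b" by auto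
      then show ?thesis using True free[OF e(2)] ab pe by auto
    next
      case False
      then have "{#prefix_weight e, card V - prefix_weight e - 1#} = {#a, b#}"
        using comp_partition_cut[OF A(1) W D] A(2) by simp
      then have "prefix_weight e \<in># {#a, b#}" by (metis union_single_eq_member)
      then have "prefix_weight e = a \<or> prefix_weight e = b" by auto
      then show ?thesis using free[OF e(2)] by auto
    qed
    moreover from this have "e = d"
      using d e prefix_weight_mono[of e d] prefix_weight_mono[of d e] by (metis less_imp_le_nat nat_neq_iff)
    moreover have "A = F w" unfolding F_def by (subst removed_set[OF A(1)]) (auto simp: W D \<open>e = d\<close>)
    moreover have "w \<in> leaves V E" using W by (auto simp: cut_leaves_def)
    ultimately show "A \<in> ?R" by auto
  next
    fix A assume "A \<in> ?R"
    then obtain w where w: "w \<in> leaves V E" "idx w < d" "A = F w" by auto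
    then have "comp_partition V A = {#1, prefix_weight d - 1, card V - prefix_weight d#}"
      using comp_partition_cut[of A w d] cutF by auto
    moreover have "prefix_weight d - 1 = a" "card V - prefix_weight d = b" using d ab by auto
    ultimately show "A \<in> ?L" using cutF w by simp
  qed
  moreover have "inj_on F {w \<in> leaves V E. idx w < d}"
  proof (rule inj_onI)
    fix x y assume "x \<in> {w \<in> leaves V E. idx w < d}" "y \<in> {w \<in> leaves V E. idx w < d}" "F x = F y"
    then have "cut_leaves (F x) = {x}" "cut_leaves (F x) = {y}"
      using cutF(1) by (metis (no_types, lifting) mem_Collect_eq)+
    then show "x = y" by simp
  qed
  ultimately have "card {A \<in> Pow E. comp_partition V A = {#1, a, b#}} = card {w \<in> leaves V E. idx w < d}"
    by (simp add: card_image)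
  moreover have "count (U_poly V E) {#1, a, b#} = card {A \<in> Pow E. comp_partition V A = {#1, a, b#}}"
  proof -
    have "comp_partition V -` {{#1, a, b#}} \<inter> Pow E = {A \<in> Pow E. comp_partition V A = {#1, a, b#}}"
      by auto
    then show ?thesis unfolding U_poly_def count_image_mset using \<open>finite E\<close> by simp
  qed
  ultimately show ?thesis using prefix_leaves_card[of d] d by simp
qed

lemma entries_ge_2:
  assumes "x \<in> set (map (\<lambda>v. 1 + leaf_count V E v) vs)"
  shows "2 \<le> x"
proof -
  obtain v where v: "v \<in> set vs" "x = 1 + leaf_count V E v" using assms by auto
  then have "\<exists>w\<in>leaves V E. adj E v w"
    using proper set_vs unfolding is_proper_caterpillar_def internal_def by blast
  moreover have "finite {w \<in> leaves V E. adj E v w}"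
    using finite_V leaf_in_V by (auto intro: finite_subset)
  ultimately have "0 < leaf_count V E v" unfolding leaf_count_def by (auto simp: card_gt_0_iff)
  then show ?thesis using v by simp
qed

text \<open>The index of the cut equals the number of positive partial sums up to \<open>s\<close>,
  which removes the graph from the formula. The bounds on \<open>s\<close> make both large parts at
  least 2.\<close>

lemma count_U_poly_psums:
  fixes \<theta> :: "nat list" and s :: nat
  defines "\<theta> \<equiv> map (\<lambda>v. 1 + leaf_count V E v) vs"
  assumes s: "s \<in> psums \<theta>" "3 \<le> s" "s + 2 \<le> sum_list \<theta>"
    and free: "sum_list \<theta> - s \<notin> psums \<theta>" "sum_list \<theta> - s + 1 \<notin> psums \<theta>"
  shows "count (U_poly V E) {#1, s - 1, sum_list \<theta> - s#} + card (psums \<theta> \<inter> {1..s}) = s"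
proof -
  have pw: "prefix_weight e = sum_list (take e \<theta>)" for e
    by (simp add: prefix_weight_def \<theta>_def)
  have len: "length \<theta> = length vs" by (simp add: \<theta>_def)
  have N: "card V = sum_list \<theta>" using prefix_weight_all by (simp add: pw len[symmetric])
  have psums_pw: "psums \<theta> = prefix_weight ` {..length vs}"
    by (simp add: psums_def pw[abs_def] len)
  have mono: "prefix_weight i < prefix_weight j \<longleftrightarrow> i < j" if "i \<le> length vs" "j \<le> length vs" for i j
    using prefix_weight_mono[of i j] prefix_weight_mono[of j i] that by (cases i j rule: linorder_cases) auto
  have pw0: "prefix_weight 0 = 0" by (simp add: pw)
  obtain d where d: "d \<le> length vs" "s = prefix_weight d" using s(1) psums_pw by auto
  have "0 < d" using d(2) s(2) pw0 by (cases d) auto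
  moreover have "d < length vs"
    using d s(3) prefix_weight_all N by (cases "d = length vs") auto
  \<comment> \<open>The remaining forbidden value \<open>s - 1\<close> is excluded by the entries
    being at least 2.\<close>
  moreover have gap: "s - 1 \<notin> psums \<theta>"
  proof
    assume "s - 1 \<in> psums \<theta>"
    then have "s - 1 + 2 \<le> s" using s entries_ge_2 unfolding \<theta>_def by (intro psums_gap) auto
    then show False using s(2) by simp
  qed
  moreover have "prefix_weight e \<notin> {s - 1, sum_list \<theta> - s, sum_list \<theta> - s + 1}" if "e < length vs" for e
  proof -
    have "prefix_weight e \<in> psums \<theta>" using that psums_pw by auto
    then show ?thesis using free gap by auto
  qed
  ultimately have "count (U_poly V E) {#1, s - 1, sum_list \<theta> - s#} + d = s - 1 + 1"
    using s d(2) by (intro count_U_poly) (simp_all add: N)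
  moreover have "card (psums \<theta> \<inter> {1..s}) = d"
  proof -
    have "psums \<theta> \<inter> {1..s} = prefix_weight ` {1..d}"
    proof (intro equalityI subsetI)
      fix x assume "x \<in> psums \<theta> \<inter> {1..s}"
      then obtain e where e: "x = prefix_weight e" "e \<le> length vs" "0 < x" "x \<le> s" using psums_pw by auto
      have "0 < e" using e pw0 by (cases e) auto
      moreover have "e \<le> d" using mono[OF d(1) e(2)] e d by simp
      ultimately show "x \<in> prefix_weight ` {1..d}" using e by auto
    next
      fix x assume "x \<in> prefix_weight ` {1..d}"
      then obtain e where e: "x = prefix_weight e" "0 < e" "e \<le> d" by auto
      then have "0 < x" "x \<le> s" "e \<le> length vs"
        using mono[of 0 e] mono[of d e] pw0 d by (auto simp: not_less[symmetric])
      then show "x \<in> psums \<theta> \<inter> {1..s}" using e psums_pw by auto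
    qed
    moreover have "inj_on prefix_weight {1..d}"
    proof (rule inj_onI)
      fix x y assume "x \<in> {1..d}" "y \<in> {1..d}" "prefix_weight x = prefix_weight y"
      then show "x = y" using mono[of x y] mono[of y x] d(1) by (cases x y rule: linorder_cases) auto
    qed
    ultimately show ?thesis by (simp add: card_image)
  qed
  ultimately show ?thesis using s(2) by simp
qed

end

section \<open>Recovering the outer composition\<close>

text \<open>For positive \<open>x\<close>, both sums reappear in the last copy of \<gamma>, whose
  right end is the total. For \<open>x = 0\<close> the first copy is used instead, since the left
  end of the last copy may have been merged away; \<open>y = sum_list \<gamma>\<close> is then
  settled by the size bound.\<close>

lemma psums_gap_inner:
  assumes \<gamma>: "is_composition \<gamma>" and \<alpha>: "is_composition \<alpha>" and two: "\<forall>x\<in>set (comp_circ \<alpha> \<gamma>). 2 \<le> x"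
    and n: "2 \<le> sum_list \<gamma>" and xy: "x \<in> psums \<gamma>" "y \<in> psums \<gamma>" "x < y"
  shows "x + 2 \<le> y"
proof -
  let ?n = "sum_list \<gamma>" and ?m = "sum_list \<alpha>"
  have pos: "\<forall>a\<in>set \<alpha>. 0 < a" using \<alpha> by (simp add: is_composition_def)
  obtain k where k: "?m = Suc k" using composition_sum_pos[OF \<alpha>] gr0_conv_Suc by blast
  have top: "?n * k + ?n \<in> psums (comp_circ \<alpha> \<gamma>)"
    using sum_in_psums[of "comp_circ \<alpha> \<gamma>"] comp_circ_facts(2)[OF \<gamma> pos] k by (simp add: add.commute)
  have mem: "?n * k + z \<in> psums (comp_circ \<alpha> \<gamma>)" if "z \<in> psums \<gamma>" "0 < z" for z
    using psums_comp_circ_mem[OF \<gamma> pos, of z k] that psums_le[OF that(1)] k top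
    by (cases "z = ?n") auto
  show ?thesis
  proof (cases "x = 0")
    case False
    then have "?n * k + x + 2 \<le> ?n * k + y"
      using xy by (intro psums_gap[OF two] mem) auto
    then show ?thesis by simp
  next
    case True
    show ?thesis
    proof (cases "y = ?n")
      case False
      then have "?n * 0 + y \<in> psums (comp_circ \<alpha> \<gamma>)"
        using psums_comp_circ_mem[OF \<gamma> pos, of y 0] xy psums_le[OF xy(2)] k by auto
      then have "0 + 2 \<le> ?n * 0 + y"
        using xy True by (intro psums_gap[OF two]) auto
      then show ?thesis using True by simp
    qed (use n True in simp)
  qed
qed

text \<open>The non-palindromic \<gamma> enters only through \<open>q\<close>, so the lemma applies
  equally to the reversed compositions.\<close>

lemma composition_determined:
  assumes \<alpha>: "is_composition \<alpha>" and \<beta>: "is_composition \<beta>" and \<gamma>: "is_composition \<gamma>"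
    and sum: "sum_list \<alpha> = sum_list \<beta>"
    and S: "spined_caterpillar VS ES us" and T: "spined_caterpillar VT ET vs"
    and us: "map (\<lambda>v. 1 + leaf_count VS ES v) us = comp_circ \<alpha> \<gamma>"
    and vs: "map (\<lambda>v. 1 + leaf_count VT ET v) vs = comp_circ \<beta> \<gamma>"
    and U: "U_poly VS ES = U_poly VT ET"
    and q: "q \<in> psums \<gamma>" "sum_list \<gamma> - q \<notin> psums \<gamma>" "sum_list \<gamma> - q + 1 \<notin> psums \<gamma>"
  shows "\<alpha> = \<beta>"
proof -
  let ?n = "sum_list \<gamma>" and ?m = "sum_list \<alpha>"
  have pos: "\<forall>a\<in>set \<alpha>. 0 < a" "\<forall>a\<in>set \<beta>. 0 < a"
    using \<alpha> \<beta> by (simp_all add: is_composition_def)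
  have q0: "0 < q" using q(2) by (cases "q = 0") auto
  have qn: "q < ?n" using q(2) psums_le[OF q(1)] by (cases "q = ?n") auto
  have two: "\<forall>x\<in>set (comp_circ \<alpha> \<gamma>). 2 \<le> x"
    using spined_caterpillar.entries_ge_2[OF S, unfolded us] by blast
  have n2: "2 \<le> ?n" using q0 qn by simp
  note gap = psums_gap_inner[OF \<gamma> \<alpha> two n2]
  have q2: "2 \<le> q" "q + 2 \<le> ?n" using gap[of 0 q] gap[of q ?n] q q0 qn by simp_all
  have "card (psums \<alpha> \<inter> {1..j}) = card (psums \<beta> \<inter> {1..j})" if j: "0 < j" "j < ?m" for j
  proof -
    let ?s = "?n * j + q"
    obtain i where i: "?m = Suc (j + i)" using j less_imp_Suc_add by blast
    \<comment> \<open>Both critical values get remainders \<open>?n - q\<close> and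
      \<open>?n - q + 1\<close> strictly between 0 and \<open>?n\<close>, the latter because
      \<open>2 \<le> q\<close>; their membership is thus decided by \<gamma>.\<close>
    have N: "?n * ?m - ?s = ?n * i + (?n - q)" "?n * ?m - ?s + 1 = ?n * i + (?n - q + 1)"
      using q2 by (simp_all add: i distrib_left)
    have s3: "3 \<le> ?s" using q2 j n2 by (cases j) auto
    have sN: "?s + 2 \<le> ?n * ?m" using q2 by (simp add: i distrib_left)
    have mem: "?s \<in> psums (comp_circ \<delta> \<gamma>)" "?n * ?m - ?s \<notin> psums (comp_circ \<delta> \<gamma>)"
      "?n * ?m - ?s + 1 \<notin> psums (comp_circ \<delta> \<gamma>)"
      if "\<forall>a\<in>set \<delta>. 0 < a" "sum_list \<delta> = ?m" for \<delta>
      unfolding N using psums_comp_circ_mem[OF \<gamma> that(1), of q j]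
        psums_comp_circ_mem[OF \<gamma> that(1), of "?n - q" i]
        psums_comp_circ_mem[OF \<gamma> that(1), of "?n - q + 1" i] that(2) q q2 j by auto
    have "count (U_poly VS ES) {#1, ?s - 1, ?n * ?m - ?s#} + card (psums (comp_circ \<alpha> \<gamma>) \<inter> {1..?s}) = ?s"
      using spined_caterpillar.count_U_poly_psums[OF S, of ?s] s3 sN mem[OF pos(1)]
      unfolding us comp_circ_facts(2)[OF \<gamma> pos(1)] by simp
    moreover have "count (U_poly VT ET) {#1, ?s - 1, ?n * ?m - ?s#} + card (psums (comp_circ \<beta> \<gamma>) \<inter> {1..?s}) = ?s"
      using spined_caterpillar.count_U_poly_psums[OF T, of ?s] s3 sN mem[OF pos(2)]
      unfolding vs comp_circ_facts(2)[OF \<gamma> pos(2)] by (simp add: sum)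
    ultimately have "card (psums (comp_circ \<alpha> \<gamma>) \<inter> {1..?s}) = card (psums (comp_circ \<beta> \<gamma>) \<inter> {1..?s})"
      using U by simp
    then show ?thesis
      using card_psums_comp_circ[OF \<gamma> pos(1) qn, of j] card_psums_comp_circ[OF \<gamma> pos(2) qn, of j] sum by simp
  qed
  then have "psums \<alpha> = psums \<beta>" using psums_eqI_card[OF sum] by blast
  then show ?thesis using psums_inj pos by blast
qed

theorem theorem3p3:
  fixes \<alpha> \<beta> \<gamma> :: "nat list"
    and VS :: "'a set" and ES :: "'a set set"
    and VT :: "'b set" and ET :: "'b set set"
  assumes "is_composition \<alpha>" and "is_composition \<beta>" and "is_composition \<gamma>"
    and "comp_size \<alpha> = comp_size \<beta>"
    and "is_proper_caterpillar VS ES" and "is_proper_caterpillar VT ET"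
    and "Phi VS ES = {comp_circ \<alpha> \<gamma>, rev (comp_circ \<alpha> \<gamma>)}"
    and "Phi VT ET = {comp_circ \<beta> \<gamma>, rev (comp_circ \<beta> \<gamma>)}"
    and "\<not> is_palindrome \<gamma>" and "\<alpha> \<noteq> \<beta>"
  shows "U_poly VS ES \<noteq> U_poly VT ET"
proof
  assume U: "U_poly VS ES = U_poly VT ET"
  note comps = assms(1-3)
  let ?n = "sum_list \<gamma>"
  have sum: "sum_list \<alpha> = sum_list \<beta>" using assms(4) by (simp add: comp_size_def)
  have pos: "\<forall>a\<in>set \<alpha>. 0 < a" "\<forall>a\<in>set \<beta>. 0 < a" "\<forall>a\<in>set \<gamma>. 0 < a"
    using comps by (simp_all add: is_composition_def)
  have S: "\<exists>us. spined_caterpillar VS ES us \<and> map (\<lambda>v. 1 + leaf_count VS ES v) us = \<theta>"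
    if "\<theta> \<in> {comp_circ \<alpha> \<gamma>, rev (comp_circ \<alpha> \<gamma>)}" for \<theta>
    using that assms(5) unfolding assms(7)[symmetric] Phi_def spined_caterpillar_def by auto
  have T: "\<exists>vs. spined_caterpillar VT ET vs \<and> map (\<lambda>v. 1 + leaf_count VT ET v) vs = \<theta>"
    if "\<theta> \<in> {comp_circ \<beta> \<gamma>, rev (comp_circ \<beta> \<gamma>)}" for \<theta>
    using that assms(6) unfolding assms(8)[symmetric] Phi_def spined_caterpillar_def by auto
  obtain us where us: "spined_caterpillar VS ES us" "map (\<lambda>v. 1 + leaf_count VS ES v) us = comp_circ \<alpha> \<gamma>"
    using S by blast
  obtain vs where vs: "spined_caterpillar VT ET vs" "map (\<lambda>v. 1 + leaf_count VT ET v) vs = comp_circ \<beta> \<gamma>"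
    using T by blast
  \<comment> \<open>Reading the spine backwards keeps the graph, hence its U-polynomial, and
    reverses both \<alpha> and \<gamma>.\<close>
  obtain us' where us': "spined_caterpillar VS ES us'"
    "map (\<lambda>v. 1 + leaf_count VS ES v) us' = comp_circ (rev \<alpha>) (rev \<gamma>)"
    using S rev_comp_circ[OF comps(3) pos(1)] by auto
  obtain vs' where vs': "spined_caterpillar VT ET vs'"
    "map (\<lambda>v. 1 + leaf_count VT ET v) vs' = comp_circ (rev \<beta>) (rev \<gamma>)"
    using T rev_comp_circ[OF comps(3) pos(2)] by auto
  \<comment> \<open>Otherwise reflection would preserve the partial sums of \<gamma>, making
    \<gamma> a palindrome.\<close>
  have "\<exists>q. q \<in> psums \<gamma> \<and> ?n - q \<notin> psums \<gamma>"
  proof (rule ccontr)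
    assume no: "\<not> ?thesis"
    have "(\<lambda>x. ?n - x) ` psums \<gamma> = psums \<gamma>"
    proof
      show "psums \<gamma> \<subseteq> (\<lambda>x. ?n - x) ` psums \<gamma>"
      proof
        fix x assume "x \<in> psums \<gamma>"
        then have "?n - x \<in> psums \<gamma>" "x = ?n - (?n - x)" using no psums_le[of x \<gamma>] by auto
        then show "x \<in> (\<lambda>x. ?n - x) ` psums \<gamma>" by blast
      qed
    qed (use no in auto)
    then have "rev \<gamma> = \<gamma>" using pos(3) by (intro psums_inj) (simp_all add: psums_rev)
    then show False using assms(9) by (simp add: is_palindrome_def)
  qed
  then obtain q where q: "q \<in> psums \<gamma>" "?n - q \<notin> psums \<gamma>"
    and least: "\<And>x. x < q \<Longrightarrow> x \<in> psums \<gamma> \<Longrightarrow> ?n - x \<in> psums \<gamma>"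
    using exists_least_iff[of "\<lambda>q. q \<in> psums \<gamma> \<and> ?n - q \<notin> psums \<gamma>"] by blast
  have q0: "0 < q" using q(2) by (cases "q = 0") auto
  have qn: "q < ?n" using q(2) psums_le[OF q(1)] by (cases "q = ?n") auto
  have two: "\<forall>x\<in>set (comp_circ \<alpha> \<gamma>). 2 \<le> x"
    using spined_caterpillar.entries_ge_2[OF us(1), unfolded us(2)] by blast
  have "2 \<le> ?n" using q0 qn by simp
  note gap = psums_gap_inner[OF comps(3,1) two this]
  have q2: "2 \<le> q" using gap[of 0 q] q q0 by simp
  show False
  proof (cases "?n - q + 1 \<in> psums \<gamma>")
    case False
    then show False
      using composition_determined[OF comps sum us(1) vs(1) us(2) vs(2) U q] assms(10) by blast
  next
    case True
    have comps': "is_composition (rev \<alpha>)" "is_composition (rev \<beta>)" "is_composition (rev \<gamma>)"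
      using comps by (simp_all add: is_composition_def)
    have rev_mem: "?n - x \<in> psums (rev \<gamma>) \<longleftrightarrow> x \<in> psums \<gamma>" if "x \<le> ?n" for x
    proof
      assume "?n - x \<in> psums (rev \<gamma>)"
      then obtain y where y: "y \<in> psums \<gamma>" "?n - x = ?n - y" by (auto simp only: psums_rev)
      then have "x = y" using that psums_le[OF y(1)] by linarith
      then show "x \<in> psums \<gamma>" using y(1) by simp
    qed (simp add: psums_rev)
    have "q - 1 \<in> psums (rev \<gamma>)"
      using rev_mem[of "?n - q + 1"] True q2 qn by simp
    \<comment> \<open>Membership here would put \<open>q - 1\<close> next to \<open>q\<close> among
      the partial sums of \<gamma>.\<close>
    moreover have "?n - (q - 1) \<notin> psums (rev \<gamma>)"
      using rev_mem[of "q - 1"] gap[of "q - 1" q] q q2 qn by auto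
    \<comment> \<open>Membership would make \<open>q - 2\<close> a partial sum of \<gamma>, hence by
      minimality of \<open>q\<close> also \<open>?n - q + 2\<close>, which is adjacent to the
      partial sum \<open>?n - q + 1\<close>.\<close>
    moreover have "?n - (q - 1) + 1 \<notin> psums (rev \<gamma>)"
    proof
      assume "?n - (q - 1) + 1 \<in> psums (rev \<gamma>)"
      moreover have "?n - (q - 1) + 1 = ?n - (q - 2)" using q2 qn by simp
      ultimately have "?n - (q - 2) \<in> psums (rev \<gamma>)" by (simp only:)
      then have "q - 2 \<in> psums \<gamma>" using rev_mem[of "q - 2"] qn by linarith
      then have "?n - (q - 2) \<in> psums \<gamma>" using least[of "q - 2"] q2 by simp
      then show False using gap[OF True, of "?n - (q - 2)"] q2 qn by linarith
    qed
    ultimately have "rev \<alpha> = rev \<beta>"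
      using composition_determined[OF comps' _ us'(1) vs'(1) us'(2) vs'(2) U] sum by (simp add: sum_list_rev)
    then show False using assms(10) by simp
  qed
qed

end
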